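(* For every constant $a\ge 0$ there exist constants $c>0$ and $D$ such that every Boolean function $f:\{0,1\}^n\to\{0,1\}$ (for any $n$) with $\mathsf{alt}(f)\le a$ and $\deg(f)\ge D$ satisfies $\log_2\mathsf{sparsity}(f)\ge c\sqrt{\deg(f)}$. (That is, for Boolean functions with $\mathsf{alt}(f)=O(1)$, $\log\mathsf{sparsity}(f)=\Omega(\sqrt{\deg(f)})$.)
   Context: $\mathsf{alt}(f)$ is the maximum, over chains $0^n=x_0\prec x_1\prec\dots\prec x_n=1^n$ of distinct inputs (with $\prec$ the coordinatewise order), of the number of $i$ with $f(x_{i-1})\ne f(x_i)$. $\deg(f)$ is the degree of the unique multilinear real polynomial agreeing with $f$ on $\{0,1\}^n$. $\mathsf{sparsity}(f)$ is the number of nonzero Fourier coefficients of $1-2f$. *)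

theory Defs
  imports Complex_Main "HOL-Library.FuncSet"
begin

definition cube :: "nat \<Rightarrow> (nat \<Rightarrow> nat) set" where
  "cube n = {..<n} \<rightarrow>\<^sub>E {0, 1}"

definition const_point :: "nat \<Rightarrow> nat \<Rightarrow> (nat \<Rightarrow> nat)" where
  "const_point n b = (\<lambda>i\<in>{..<n}. b)"

definition prec :: "nat \<Rightarrow> (nat \<Rightarrow> nat) \<Rightarrow> (nat \<Rightarrow> nat) \<Rightarrow> bool" where
  "prec n x y \<longleftrightarrow> (\<forall>i<n. x i \<le> y i) \<and> x \<noteq> y"

text \<open>Only the values of \<open>X\<close> at \<open>0, \<dots>, n\<close> are relevant.\<close>

definition is_chain :: "nat \<Rightarrow> (nat \<Rightarrow> nat \<Rightarrow> nat) \<Rightarrow> bool" where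
  "is_chain n X \<longleftrightarrow>
     (\<forall>i\<le>n. X i \<in> cube n) \<and> X 0 = const_point n 0 \<and> X n = const_point n 1 \<and>
     (\<forall>i\<in>{1..n}. prec n (X (i - 1)) (X i))"

definition alt :: "nat \<Rightarrow> ((nat \<Rightarrow> nat) \<Rightarrow> nat) \<Rightarrow> nat" where
  "alt n f = Max {card {i \<in> {1..n}. f (X (i - 1)) \<noteq> f (X i)} | X. is_chain n X}"

text \<open>A multilinear real polynomial in the variables \<open>x\<^sub>0, \<dots>, x\<^sub>n\<^sub>-\<^sub>1\<close> is given by its
  coefficients \<open>p S\<close>, one for each monomial \<open>\<Prod>i\<in>S. x i\<close> with \<open>S \<subseteq> {..<n}\<close>.\<close>

definition multilinear_eval :: "nat \<Rightarrow> (nat set \<Rightarrow> real) \<Rightarrow> (nat \<Rightarrow> nat) \<Rightarrow> real" where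
  "multilinear_eval n p x = (\<Sum>S\<in>Pow {..<n}. p S * (\<Prod>i\<in>S. real (x i)))"

definition represents :: "nat \<Rightarrow> (nat set \<Rightarrow> real) \<Rightarrow> ((nat \<Rightarrow> nat) \<Rightarrow> nat) \<Rightarrow> bool" where
  "represents n p f \<longleftrightarrow>
     p \<in> extensional (Pow {..<n}) \<and> (\<forall>x\<in>cube n. multilinear_eval n p x = real (f x))"

definition multilinear_poly :: "nat \<Rightarrow> ((nat \<Rightarrow> nat) \<Rightarrow> nat) \<Rightarrow> (nat set \<Rightarrow> real)" where
  "multilinear_poly n f = (THE p. represents n p f)"

text \<open>The zero polynomial gets degree \<open>0\<close>.\<close>

definition deg :: "nat \<Rightarrow> ((nat \<Rightarrow> nat) \<Rightarrow> nat) \<Rightarrow> nat" where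
  "deg n f = Max (insert 0 (card ` {S \<in> Pow {..<n}. multilinear_poly n f S \<noteq> 0}))"

definition fourier_coeff :: "nat \<Rightarrow> ((nat \<Rightarrow> nat) \<Rightarrow> real) \<Rightarrow> nat set \<Rightarrow> real" where
  "fourier_coeff n g S = (\<Sum>x\<in>cube n. g x * (- 1) ^ (\<Sum>i\<in>S. x i)) / 2 ^ n"

definition sparsity :: "nat \<Rightarrow> ((nat \<Rightarrow> nat) \<Rightarrow> nat) \<Rightarrow> nat" where
  "sparsity n f = card {S \<in> Pow {..<n}. fourier_coeff n (\<lambda>x. 1 - 2 * real (f x)) S \<noteq> 0}"


text \<open>Well-definedness of \<^const>\<open>multilinear_poly\<close> and of the maximum in \<^const>\<open>alt\<close>.\<close>

definition indic :: "nat \<Rightarrow> nat set \<Rightarrow> (nat \<Rightarrow> nat)" where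
  "indic n T = (\<lambda>i\<in>{..<n}. if i \<in> T then 1 else 0)"

lemma indic_in_cube: "indic n T \<in> cube n"
  by (auto simp: indic_def cube_def)

lemma cube_eq_indic:
  assumes "x \<in> cube n"
  shows "x = indic n {i \<in> {..<n}. x i = 1}"
proof
  fix i
  show "x i = indic n {i \<in> {..<n}. x i = 1} i"
    using assms by (cases "i < n") (auto simp: indic_def cube_def PiE_def Pi_def extensional_def)
qed

lemma multilinear_eval_indic:
  assumes "T \<subseteq> {..<n}"
  shows "multilinear_eval n p (indic n T) = (\<Sum>S\<in>Pow T. p S)"
proof -
  have mono: "(\<Prod>i\<in>S. real (indic n T i)) = (if S \<subseteq> T then 1 else 0)" if "S \<subseteq> {..<n}" for S
  proof (cases "S \<subseteq> T")
    case True
    then have "(\<Prod>i\<in>S. real (indic n T i)) = (\<Prod>i\<in>S. 1)"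
      using that by (intro prod.cong) (auto simp: indic_def)
    then show ?thesis using True by simp
  next
    case False
    then obtain i where "i \<in> S" "i \<notin> T" by auto
    moreover have "finite S" using that finite_subset by blast
    ultimately show ?thesis using that by (auto simp: indic_def intro!: bexI[of _ i])
  qed
  have "multilinear_eval n p (indic n T) = (\<Sum>S\<in>Pow {..<n}. if S \<in> Pow T then p S else 0)"
    unfolding multilinear_eval_def by (intro sum.cong) (auto simp: mono)
  also have "\<dots> = (\<Sum>S\<in>Pow {..<n} \<inter> Pow T. p S)"
    by (simp add: sum.inter_restrict)
  also have "Pow {..<n} \<inter> Pow T = Pow T" using assms by auto
  finally show ?thesis .
qed

lemma represents_ex: "\<exists>p. represents n p f"
proof -
  define h where "h T = real (f (indic n T))" for T
  define g where "g S = (\<Sum>T\<in>Pow S. (- 1) ^ card T * h T)" for S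
  have inv: "h S = (\<Sum>T\<in>Pow S. (- 1) ^ card T * g T)" if "finite S" for S
    by (rule inclusion_exclusion_symmetric) (use that in \<open>auto simp: g_def\<close>)
  define p where "p = (\<lambda>T\<in>Pow {..<n}. (- 1) ^ card T * g T)"
  have "multilinear_eval n p x = real (f x)" if x: "x \<in> cube n" for x
  proof -
    define T where "T = {i \<in> {..<n}. x i = 1}"
    have T: "T \<subseteq> {..<n}" "finite T" "x = indic n T"
      using cube_eq_indic[OF x] by (auto simp: T_def)
    have "multilinear_eval n p x = (\<Sum>S\<in>Pow T. p S)"
      using multilinear_eval_indic[OF T(1)] T(3) by simp
    also have "\<dots> = h T"
      unfolding inv[OF T(2)] using T(1) by (intro sum.cong) (auto simp: p_def)
    finally show ?thesis using T(3) by (simp add: h_def)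
  qed
  then have "represents n p f" by (simp add: represents_def p_def)
  then show ?thesis by blast
qed

lemma represents_unique:
  assumes "represents n p f" "represents n q f"
  shows "p = q"
proof -
  have eq: "(\<Sum>S\<in>Pow T. p S) = (\<Sum>S\<in>Pow T. q S)" if "T \<subseteq> {..<n}" for T
    using assms indic_in_cube[of n T] multilinear_eval_indic[OF that]
    unfolding represents_def by metis
  have "p T = q T" if "T \<subseteq> {..<n}" for T
  proof -
    have "finite T" using that finite_subset by blast
    then show ?thesis using that
    proof (induction T rule: finite_psubset_induct)
      case (psubset T)
      have "(\<Sum>S\<in>Pow T - {T}. p S) = (\<Sum>S\<in>Pow T - {T}. q S)"
        using psubset by (intro sum.cong) auto
      moreover have "sum r (Pow T) = r T + (\<Sum>S\<in>Pow T - {T}. r S)" for r :: "nat set \<Rightarrow> real"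
        using psubset.hyps by (intro sum.remove) auto
      ultimately show ?case using eq[OF psubset.prems] by simp
    qed
  qed
  then show ?thesis
    using assms by (intro extensionalityI[of p "Pow {..<n}" q]) (auto simp: represents_def)
qed

lemma represents_multilinear_poly: "represents n (multilinear_poly n f) f"
  unfolding multilinear_poly_def
  by (rule theI'[of "\<lambda>p. represents n p f"]) (use represents_ex represents_unique in blast)

lemma ex_is_chain: "\<exists>X. is_chain n X"
proof -
  have "indic n {..<i - 1} \<noteq> indic n {..<i}" if "i \<in> {1..n}" for i
  proof
    assume "indic n {..<i - 1} = indic n {..<i}"
    then have "indic n {..<i - 1} (i - 1) = indic n {..<i} (i - 1)" by simp
    moreover have "i - 1 < n" "i - 1 < i" using that by auto
    ultimately show False by (simp add: indic_def)
  qed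
  then have "is_chain n (\<lambda>i. indic n {..<i})"
    by (auto simp: is_chain_def prec_def indic_in_cube const_point_def)
       (auto simp: indic_def)
  then show ?thesis by blast
qed

lemma finite_alternations:
  "finite {card {i \<in> {1..n}. f (X (i - 1)) \<noteq> f (X i)} | X. is_chain n X}"
proof (rule finite_subset)
  show "{card {i \<in> {1..n}. f (X (i - 1)) \<noteq> f (X i)} | X. is_chain n X} \<subseteq> {..n}"
  proof clarsimp
    fix X :: "nat \<Rightarrow> nat \<Rightarrow> nat"
    have "card {i \<in> {1..n}. f (X (i - 1)) \<noteq> f (X i)} \<le> card {1..n}"
      by (rule card_mono) auto
    then show "card {i. Suc 0 \<le> i \<and> i \<le> n \<and> f (X (i - Suc 0)) \<noteq> f (X i)} \<le> n"
      by (simp add: conj_assoc)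
  qed
qed simp

end

theory Submission
  imports Defs
begin

text \<open>
  Huang's theorem gives \<open>deg(f) \<le> s(f)\<^sup>2\<close> for the sensitivity \<open>s(f)\<close>, so it suffices to bound
  \<open>s(f)\<close> by \<open>2 alt(f) (log\<^sub>2 sparsity(f) + 1)\<close>. If, on an interval of dimension \<open>m\<close>, \<open>f\<close> takes
  one value at a single point and another value elsewhere, then its restriction to the interval
  has at least \<open>2\<^sup>m - 1\<close> nonzero Fourier coefficients, and restricting does not increase sparsity.
  Now let all coordinates of the interval \<open>[S, U]\<close> be sensitive at \<open>S\<close>, and walk down from \<open>U\<close>,
  moving each time to a maximal point below where the value changes. The interval skipped in
  each move has an isolated value at its bottom, so it has dimension at most
  \<open>log\<^sub>2 sparsity(f) + 1\<close>; there are at most \<open>alt(f)\<close> moves, and the walk can only stop at \<open>S\<close>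
  because \<open>f\<close> is not constant on any larger interval above \<open>S\<close>. Downward sensitive coordinates
  are treated dually.
\<close>

section \<open>Homogeneous linear systems\<close>

text \<open>Gaussian elimination, by induction on the equations: an equation \<open>e\<close> with a
  nonzero coefficient at \<open>v\<close> is used to remove \<open>v\<close> from the others, which
  leaves one equation and one unknown fewer. This replaces an argument on dimensions of vector
  spaces.\<close>

lemma homogeneous_system_nontrivial:
  fixes M :: "'e \<Rightarrow> 'u \<Rightarrow> real"
  assumes "finite E" "finite U" "card E < card U"
  shows "\<exists>x. (\<exists>u\<in>U. x u \<noteq> 0) \<and> (\<forall>e\<in>E. (\<Sum>u\<in>U. M e u * x u) = 0)"
  using assms
proof (induction E arbitrary: U M rule: finite_induct)
  case empty
  then obtain u where "u \<in> U" by fastforce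
  then show ?case by (intro exI[of _ "\<lambda>_. 1"]) auto
next
  case (insert e E)
  show ?case
  proof (cases "\<forall>u\<in>U. M e u = 0")
    case True
    have "card E < card U" using insert by simp
    then obtain x where "\<exists>u\<in>U. x u \<noteq> 0" "\<forall>e\<in>E. (\<Sum>u\<in>U. M e u * x u) = 0"
      using insert.IH[of U M] insert.prems by blast
    then show ?thesis using True by (intro exI[of _ x]) auto
  next
    case False
    then obtain v where v: "v \<in> U" "M e v \<noteq> 0" by blast
    have "card E < card (U - {v})" using insert v by simp
    then obtain x where x: "\<exists>u\<in>U - {v}. x u \<noteq> 0"
      "\<forall>e'\<in>E. (\<Sum>u\<in>U - {v}. (M e' u - M e' v * M e u / M e v) * x u) = 0"
      using insert.IH[of "U - {v}" "\<lambda>e' u. M e' u - M e' v * M e u / M e v"] insert.prems by auto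
    define s where "s = (\<Sum>u\<in>U - {v}. M e u * x u)"
    \<comment> \<open>Back-substitution: equation \<open>e\<close> forces this value at
      \<open>v\<close>, and it turns every other equation into its reduced form.\<close>
    define z where "z = x(v := - s / M e v)"
    have eval: "(\<Sum>u\<in>U. M e' u * z u) = (\<Sum>u\<in>U - {v}. M e' u * x u) - M e' v * s / M e v" for e'
    proof -
      have "(\<Sum>u\<in>U. M e' u * z u) = M e' v * z v + (\<Sum>u\<in>U - {v}. M e' u * z u)"
        using v insert.prems by (intro sum.remove) auto
      moreover have "(\<Sum>u\<in>U - {v}. M e' u * z u) = (\<Sum>u\<in>U - {v}. M e' u * x u)"
        by (intro sum.cong) (auto simp: z_def)
      ultimately show ?thesis by (simp add: z_def)
    qed
    have "(\<Sum>u\<in>U. M e' u * z u) = 0" if "e' \<in> E" for e'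
    proof -
      have "(\<Sum>u\<in>U - {v}. (M e' u - M e' v * M e u / M e v) * x u)
          = (\<Sum>u\<in>U - {v}. M e' u * x u) - M e' v * s / M e v"
        by (simp add: s_def sum_distrib_left sum_divide_distrib sum_subtractf[symmetric] algebra_simps)
      then show ?thesis using x(2) that eval by simp
    qed
    moreover have "(\<Sum>u\<in>U. M e u * z u) = 0" using v by (simp add: eval s_def)
    moreover have "\<exists>u\<in>U. z u \<noteq> 0" using x(1) by (auto simp: z_def)
    ultimately show ?thesis by (intro exI[of _ z]) auto
  qed
qed

section \<open>Induced subgraphs of the hypercube\<close>

definition flip :: "nat \<Rightarrow> nat set \<Rightarrow> nat set" where
  "flip i S = (if i \<in> S then S - {i} else insert i S)"

lemma flip_flip [simp]: "flip i (flip i S) = S"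
  by (auto simp: flip_def)

lemma flip_commute: "flip i (flip j S) = flip j (flip i S)"
  by (auto simp: flip_def)

lemma mem_flip: "j \<in> flip i S \<longleftrightarrow> (if j = i then i \<notin> S else j \<in> S)"
  by (auto simp: flip_def)

lemma flip_in_Pow: "i \<in> V \<Longrightarrow> S \<in> Pow V \<Longrightarrow> flip i S \<in> Pow V"
  by (auto simp: flip_def)

lemma minus_one_power_card_flip:
  assumes "finite S"
  shows "(- 1 :: real) ^ card (flip i S) = - ((- 1) ^ card S)"
proof (cases "i \<in> S")
  case True
  then have "card S = Suc (card (S - {i}))" using assms by (metis card.remove)
  then show ?thesis using True by (simp add: flip_def del: card_Diff_insert card_Diff_singleton)
qed (use assms in \<open>simp add: flip_def\<close>)

text \<open>Huang's signing of the cube edges. Whether \<open>i\<close> itself lies in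
  \<open>S\<close> does not matter, so both ends of an edge in direction \<open>i\<close> give it
  the same sign.\<close>

definition edge_sign :: "nat \<Rightarrow> nat set \<Rightarrow> real" where
  "edge_sign i S = (- 1) ^ card (S \<inter> {..<i})"

lemma edge_sign_flip:
  "edge_sign i (flip j S) = (if j < i then - edge_sign i S else edge_sign i S)"
proof (cases "j < i")
  case True
  then have "flip j S \<inter> {..<i} = flip j (S \<inter> {..<i})" by (auto simp: flip_def)
  then show ?thesis using True by (simp add: edge_sign_def minus_one_power_card_flip)
next
  case False
  then have "flip j S \<inter> {..<i} = S \<inter> {..<i}" by (auto simp: flip_def)
  then show ?thesis using False by (simp add: edge_sign_def)
qed

lemma edge_sign_square [simp]: "edge_sign i S * edge_sign i S = 1"
  by (simp add: edge_sign_def power_add[symmetric])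

lemma abs_edge_sign [simp]: "\<bar>edge_sign i S\<bar> = 1"
  by (simp add: edge_sign_def power_abs)

definition signed_adj :: "nat set \<Rightarrow> (nat set \<Rightarrow> real) \<Rightarrow> nat set \<Rightarrow> real" where
  "signed_adj V y S = (\<Sum>i\<in>V. edge_sign i S * y (flip i S))"

text \<open>The signs are chosen so that the two paths around every 4-cycle of the cube cancel.\<close>

lemma signed_adj_square:
  "signed_adj V (signed_adj V y) S = real (card V) * y S"
proof -
  define t where "t i j = edge_sign i S * (edge_sign j (flip i S) * y (flip j (flip i S)))" for i j
  \<comment> \<open>For distinct directions exactly one of \<open>i < j\<close> and
    \<open>j < i\<close> holds, so exactly one of the two products changes sign. Symmetrizing the
    double sum then leaves only its diagonal.\<close>
  have anti: "t i j + t j i = (if i = j then 2 * y S else 0)" for i j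
  proof (cases "i = j")
    case True
    have "t i i = (edge_sign i S * edge_sign i S) * y S" by (simp add: t_def edge_sign_flip)
    then show ?thesis using True by simp
  next
    case False
    then show ?thesis
      by (auto simp: t_def edge_sign_flip flip_commute[of i j] not_less_iff_gr_or_eq)
  qed
  have sq: "signed_adj V (signed_adj V y) S = (\<Sum>i\<in>V. \<Sum>j\<in>V. t i j)"
    by (simp add: signed_adj_def t_def sum_distrib_left)
  have "2 * (\<Sum>i\<in>V. \<Sum>j\<in>V. t i j) = (\<Sum>i\<in>V. \<Sum>j\<in>V. t i j) + (\<Sum>i\<in>V. \<Sum>j\<in>V. t j i)"
    by (subst (3) sum.swap) simp
  also have "\<dots> = (\<Sum>i\<in>V. \<Sum>j\<in>V. if i = j then 2 * y S else 0)"
    by (simp add: sum.distrib[symmetric] anti)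
  also have "\<dots> = 2 * (real (card V) * y S)"
    by (cases "finite V") simp_all
  finally show ?thesis using sq by simp
qed

lemma signed_adj_add_scaled:
  "signed_adj V (\<lambda>S. y S + c * z S) S = signed_adj V y S + c * signed_adj V z S"
  by (simp add: signed_adj_def sum.distrib sum_distrib_left algebra_simps)

text \<open>Since the signed adjacency operator \<open>A\<close> satisfies \<open>A\<^sup>2 = r\<^sup>2\<close>, every \<open>y = (A + r) z\<close> is an
  \<open>r\<close>-eigenvector. By counting dimensions, some \<open>z \<noteq> 0\<close> supported on a facet makes \<open>y\<close> vanish
  outside \<open>H\<close>; a vertex where \<open>\<bar>y\<bar>\<close> is largest then has degree at least \<open>r\<close> in \<open>H\<close>.\<close>

theorem induced_subcube_degree:
  assumes V: "finite V" "V \<noteq> {}" and H: "H \<subseteq> Pow V" "2 ^ (card V - 1) < card H"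
  shows "\<exists>T\<in>H. sqrt (card V) \<le> card {i \<in> V. flip i T \<in> H}"
proof -
  define r where "r = sqrt (card V)"
  have rr: "r * r = card V" by (simp add: r_def)
  obtain m where m: "m \<in> V" using V by blast
  \<comment> \<open>The facet of the sets avoiding \<open>m\<close>. It holds half of the cube,
    hence more vertices than lie outside \<open>H\<close>.\<close>
  define U where "U = Pow (V - {m})"
  have U: "finite U" "card U = 2 ^ (card V - 1)" using V m by (simp_all add: U_def card_Pow)
  have "card (Pow V - H) = card (Pow V) - card H"
    using H V by (intro card_Diff_subset) (auto intro: finite_subset)
  moreover have "card (Pow V) = 2 * 2 ^ (card V - 1)"
    using V m by (simp add: card_Pow card_gt_0_iff flip: power_Suc)
  moreover have "(0::nat) < 2 ^ (card V - 1)" by simp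
  ultimately have "card (Pow V - H) < card U" using H(2) U(2) by linarith
  moreover have "finite (Pow V - H)" using V by simp
  \<comment> \<open>The unknowns are the values of \<open>z\<close> on the facet; each vertex
    \<open>e\<close> outside \<open>H\<close> gives the equation that \<open>(A + r) z\<close>
    vanishes at \<open>e\<close>.\<close>
  ultimately obtain x where x: "\<exists>u\<in>U. x u \<noteq> 0"
    "\<forall>e\<in>Pow V - H. (\<Sum>u\<in>U. (signed_adj V (\<lambda>S. of_bool (S = u)) e + r * of_bool (e = u)) * x u) = 0"
    using homogeneous_system_nontrivial[of "Pow V - H" U
      "\<lambda>e u. signed_adj V (\<lambda>S. of_bool (S = u)) e + r * of_bool (e = u)"] U(1) by blast
  define z where "z S = (if S \<in> U then x S else 0)" for S
  define y where "y S = signed_adj V z S + r * z S" for S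
  have z_sum: "(\<Sum>u\<in>U. of_bool (S = u) * x u) = z S" for S
  proof -
    have "(\<Sum>u\<in>U. of_bool (S = u) * x u) = (\<Sum>u\<in>U. if S = u then x u else 0)"
      by (intro sum.cong) auto
    then show ?thesis using U by (simp add: z_def)
  qed
  have y_sum: "(\<Sum>u\<in>U. (signed_adj V (\<lambda>S. of_bool (S = u)) e + r * of_bool (e = u)) * x u) = y e" for e
  proof -
    have "(\<Sum>u\<in>U. signed_adj V (\<lambda>S. of_bool (S = u)) e * x u)
        = (\<Sum>u\<in>U. \<Sum>i\<in>V. edge_sign i e * (of_bool (flip i e = u) * x u))"
      by (simp add: signed_adj_def sum_distrib_right mult.assoc)
    also have "\<dots> = (\<Sum>i\<in>V. \<Sum>u\<in>U. edge_sign i e * (of_bool (flip i e = u) * x u))"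
      by (rule sum.swap)
    also have "\<dots> = signed_adj V z e"
      by (simp only: sum_distrib_left[symmetric] z_sum signed_adj_def)
    finally have 1: "(\<Sum>u\<in>U. signed_adj V (\<lambda>S. of_bool (S = u)) e * x u) = signed_adj V z e" .
    have "(\<Sum>u\<in>U. r * of_bool (e = u) * x u) = r * z e"
      by (simp only: mult.assoc sum_distrib_left[symmetric] z_sum)
    with 1 show ?thesis by (simp only: distrib_right sum.distrib y_def)
  qed
  have y_off: "y S = 0" if "S \<in> Pow V" "S \<notin> H" for S
    using x(2) that y_sum by simp
  have eig: "signed_adj V y S = r * y S" for S
    unfolding y_def signed_adj_add_scaled
    by (simp add: signed_adj_square rr[symmetric] algebra_simps)
  obtain u where u: "u \<in> U" "x u \<noteq> 0" using x(1) by blast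
  \<comment> \<open>This shows \<open>y\<close> to be nonzero: \<open>insert m u\<close> lies off
    the facet, and its only neighbour on the facet is \<open>u\<close>, where \<open>x\<close> does
    not vanish.\<close>
  have "y (insert m u) = (\<Sum>i\<in>V. if i = m then edge_sign m (insert m u) * x u else 0)"
  proof -
    have "insert m u \<notin> U" by (auto simp: U_def)
    then have "y (insert m u) = signed_adj V z (insert m u)" by (simp add: y_def z_def)
    also have "\<dots> = (\<Sum>i\<in>V. if i = m then edge_sign m (insert m u) * x u else 0)"
      unfolding signed_adj_def
    proof (intro sum.cong refl)
      fix i assume "i \<in> V"
      show "edge_sign i (insert m u) * z (flip i (insert m u))
          = (if i = m then edge_sign m (insert m u) * x u else 0)"
      proof (cases "i = m")
        case True
        have "flip m (insert m u) = u" using u by (auto simp: flip_def U_def)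
        then show ?thesis using True u by (simp add: z_def)
      next
        case False
        then have "m \<in> flip i (insert m u)" by (simp add: mem_flip)
        then show ?thesis using False by (auto simp: z_def U_def)
      qed
    qed
    finally show ?thesis .
  qed
  then have "\<bar>y (insert m u)\<bar> = \<bar>x u\<bar>" using V m by (simp add: abs_mult)
  then have pos: "\<bar>y (insert m u)\<bar> > 0" using u by simp
  have mu: "insert m u \<in> Pow V" using u m by (auto simp: U_def)
  obtain T where T: "T \<in> Pow V" "\<And>S. S \<in> Pow V \<Longrightarrow> \<bar>y S\<bar> \<le> \<bar>y T\<bar>"
  proof -
    have fin: "finite ((\<lambda>S. \<bar>y S\<bar>) ` Pow V)" using V by simp
    then have "Max ((\<lambda>S. \<bar>y S\<bar>) ` Pow V) \<in> (\<lambda>S. \<bar>y S\<bar>) ` Pow V" by (rule Max_in) auto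
    then obtain T where "T \<in> Pow V" "Max ((\<lambda>S. \<bar>y S\<bar>) ` Pow V) = \<bar>y T\<bar>" by blast
    with that Max_ge[OF fin] show thesis by (metis imageI)
  qed
  have yT: "\<bar>y T\<bar> > 0" using T(2)[OF mu] pos by linarith
  then have "T \<in> H" using y_off[OF T(1)] by (metis abs_zero less_irrefl)
  \<comment> \<open>The eigenvalue equation is read at \<open>T\<close>: neighbours outside
    \<open>H\<close> contribute nothing, the others at most \<open>\<bar>y T\<bar>\<close>
    each.\<close>
  have "r * \<bar>y T\<bar> = \<bar>signed_adj V y T\<bar>" by (simp add: eig abs_mult r_def)
  also have "\<dots> \<le> (\<Sum>i\<in>V. \<bar>y (flip i T)\<bar>)"
    unfolding signed_adj_def by (rule order_trans[OF sum_abs]) (simp add: abs_mult)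
  also have "\<dots> \<le> (\<Sum>i\<in>V. if flip i T \<in> H then \<bar>y T\<bar> else 0)"
    using y_off T flip_in_Pow by (intro sum_mono) auto
  also have "\<dots> = card {i \<in> V. flip i T \<in> H} * \<bar>y T\<bar>"
    using V by (simp add: sum.If_cases Int_def)
  finally have "r \<le> card {i \<in> V. flip i T \<in> H}" using yT by simp
  then show ?thesis using \<open>T \<in> H\<close> r_def by blast
qed

section \<open>Characters of the cube\<close>

lemma sum_Pow_prod:
  fixes a :: "'a \<Rightarrow> 'b :: comm_semiring_1"
  assumes "finite M"
  shows "(\<Sum>Q\<in>Pow M. \<Prod>i\<in>Q. a i) = (\<Prod>i\<in>M. 1 + a i)"
  using prod_add[OF assms, of a "\<lambda>_. 1"] by (simp add: add.commute)

lemma minus_one_power_card_Int: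
  assumes "finite Q"
  shows "(- 1 :: real) ^ card (Q \<inter> T) = (\<Prod>i\<in>Q. if i \<in> T then - 1 else 1)"
  using assms by (simp add: prod.If_cases)

text \<open>The sum factors over the coordinates of \<open>M\<close>: one where \<open>S\<close> and
  \<open>T\<close> differ gives the factor \<open>1 - 1\<close>, any other gives
  \<open>2\<close>.\<close>

lemma character_orthogonality:
  assumes "finite M"
  shows "(\<Sum>Q\<in>Pow M. (- 1 :: real) ^ card (Q \<inter> S) * (- 1) ^ card (Q \<inter> T))
    = (if S \<inter> M = T \<inter> M then 2 ^ card M else 0)"
proof -
  define a :: "'a \<Rightarrow> real" where "a i = (if i \<in> S then - 1 else 1) * (if i \<in> T then - 1 else 1)" for i
  have "(\<Sum>Q\<in>Pow M. (- 1 :: real) ^ card (Q \<inter> S) * (- 1) ^ card (Q \<inter> T)) = (\<Sum>Q\<in>Pow M. \<Prod>i\<in>Q. a i)"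
    using assms by (intro sum.cong refl)
      (auto simp: minus_one_power_card_Int a_def prod.distrib dest: finite_subset)
  also have "\<dots> = (\<Prod>i\<in>M. 1 + a i)" by (rule sum_Pow_prod[OF assms])
  also have "\<dots> = (if S \<inter> M = T \<inter> M then 2 ^ card M else 0)"
  proof (cases "S \<inter> M = T \<inter> M")
    case True
    then have "(\<Prod>i\<in>M. 1 + a i) = (\<Prod>i\<in>M. 2)" by (intro prod.cong) (auto simp: a_def)
    then show ?thesis using True by simp
  next
    case False
    then obtain i where "i \<in> M" "i \<in> S \<longleftrightarrow> i \<notin> T" by blast
    then have "1 + a i = 0" by (auto simp: a_def)
    then show ?thesis using False \<open>i \<in> M\<close> assms by (auto simp: prod_zero_iff)
  qed
  finally show ?thesis .
qed

section \<open>Degree and sensitivity\<close>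

definition sens_coords :: "(nat set \<Rightarrow> 'a) \<Rightarrow> nat set \<Rightarrow> nat set \<Rightarrow> nat set" where
  "sens_coords F V T = {i \<in> V. F (flip i T) \<noteq> F T}"

text \<open>The Gotsman-Linial reduction. After multiplication by parity, a nonzero top coefficient
  says that the sign function \<open>g\<close> is unbalanced, so one of its level sets fills more
  than half of the cube and has a vertex of large degree. Parity alternates along edges, so
  \<open>F\<close> changes on every edge inside a level set of \<open>g\<close>.\<close>

theorem sensitivity_ge_sqrt:
  fixes F :: "nat set \<Rightarrow> nat"
  assumes V: "finite V" "V \<noteq> {}" and F: "\<And>T. T \<subseteq> V \<Longrightarrow> F T \<in> {0, 1}"
    and nz: "(\<Sum>T\<in>Pow V. (- 1) ^ card T * real (F T)) \<noteq> 0"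
  shows "\<exists>T\<subseteq>V. sqrt (card V) \<le> card (sens_coords F V T)"
proof -
  define g where "g T = (- 1) ^ card T * (1 - 2 * real (F T))" for T :: "nat set"
  have g: "g T = 1 \<or> g T = - 1" if "T \<subseteq> V" for T
    using F[OF that] by (cases "even (card T)") (auto simp: g_def)
  \<comment> \<open>Parity is balanced on a cube of positive dimension, so the sum of
    \<open>g\<close> is \<open>- 2\<close> times the sum in \<open>nz\<close>.\<close>
  have alt0: "(\<Sum>T\<in>Pow V. (- 1 :: real) ^ card T) = 0"
  proof -
    have "(\<Sum>T\<in>Pow V. (- 1 :: real) ^ card T) = (\<Sum>T\<in>Pow V. (- 1) ^ card (T \<inter> V))"
      by (intro sum.cong) (auto simp: Int_absorb2)
    then show ?thesis using character_orthogonality[OF V(1), of V "{}"] V(2) by simp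
  qed
  have sum_g: "(\<Sum>T\<in>Pow V. g T) \<noteq> 0"
  proof -
    have "(\<Sum>T\<in>Pow V. g T) = (\<Sum>T\<in>Pow V. (- 1) ^ card T) - 2 * (\<Sum>T\<in>Pow V. (- 1) ^ card T * real (F T))"
      by (simp add: g_def sum_distrib_left sum_subtractf[symmetric] algebra_simps)
    then show ?thesis using alt0 nz by simp
  qed
  define H where "H b = {T \<in> Pow V. g T = b}" for b
  have "\<exists>b. 2 ^ (card V - 1) < card (H b)"
  proof (rule ccontr)
    assume "\<not> ?thesis"
    then have le: "card (H b) \<le> 2 ^ (card V - 1)" for b by (meson not_less)
    have split: "Pow V = H 1 \<union> H (- 1)" "H 1 \<inter> H (- 1) = {}" "finite (H 1)" "finite (H (-1))"
      using g V by (auto simp: H_def)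
    have "card (Pow V) = card (H 1) + card (H (- 1))"
      using split by (metis card_Un_disjoint)
    moreover have "card (Pow V) = 2 * 2 ^ (card V - 1)"
      using V by (simp add: card_Pow card_gt_0_iff flip: power_Suc)
    \<comment> \<open>Two parts of at most half the cube that cover it are both exactly half, which
      would make \<open>g\<close> balanced.\<close>
    ultimately have "card (H 1) = card (H (- 1))" using le[of 1] le[of "- 1"] by linarith
    moreover have "(\<Sum>T\<in>Pow V. g T) = (\<Sum>T\<in>H 1. g T) + (\<Sum>T\<in>H (- 1). g T)"
      using split by (metis sum.union_disjoint)
    moreover have "(\<Sum>T\<in>H b. g T) = real (card (H b)) * b" for b by (simp add: H_def)
    ultimately show False using sum_g by (metis mult_1_right mult_minus_right add.right_inverse)
  qed
  then obtain b where b: "2 ^ (card V - 1) < card (H b)" by blast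
  then obtain T where T: "T \<in> H b" "sqrt (card V) \<le> card {i \<in> V. flip i T \<in> H b}"
    using induced_subcube_degree[OF V, of "H b"] by (auto simp: H_def)
  have "finite T" "T \<subseteq> V" using T(1) V by (auto simp: H_def intro: finite_subset)
  have "F (flip i T) \<noteq> F T" if "flip i T \<in> H b" for i
  proof
    assume "F (flip i T) = F T"
    then have "g (flip i T) = - g T"
      using \<open>finite T\<close> by (simp add: g_def minus_one_power_card_flip)
    then show False using that T(1) g[OF \<open>T \<subseteq> V\<close>] by (auto simp: H_def)
  qed
  then have "card {i \<in> V. flip i T \<in> H b} \<le> card (sens_coords F V T)"
    using V by (intro card_mono) (auto simp: sens_coords_def)
  then show ?thesis using T(2) \<open>T \<subseteq> V\<close> by (intro exI[of _ T]) linarith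
qed

section \<open>Coefficients of the multilinear polynomial\<close>

text \<open>Moebius inversion of the values \<open>f (indic n T)\<close>, each of which is the sum
  of the coefficients over the subsets of \<open>T\<close>.\<close>

lemma multilinear_poly_coeff:
  assumes "V \<subseteq> {..<n}"
  shows "multilinear_poly n f V
    = (- 1) ^ card V * (\<Sum>T\<in>Pow V. (- 1) ^ card T * real (f (indic n T)))"
proof -
  define p where "p = multilinear_poly n f"
  have ev: "real (f (indic n T)) = (\<Sum>S\<in>Pow T. p S)" if "T \<subseteq> {..<n}" for T
    using represents_multilinear_poly[of n f] indic_in_cube[of n T] multilinear_eval_indic[OF that, of p]
    unfolding represents_def p_def by metis
  \<comment> \<open>The sign is moved into \<open>q\<close> because
    \<open>inclusion_exclusion_symmetric\<close> inverts a transform that carries the sign in both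
    directions.\<close>
  define q where "q S = (- 1) ^ card S * p S" for S
  define h where "h T = (\<Sum>S\<in>Pow T. (- 1) ^ card S * q S)" for T
  have "finite V" using assms finite_subset by blast
  then have "q V = (\<Sum>T\<in>Pow V. (- 1) ^ card T * h T)"
    by (intro inclusion_exclusion_symmetric[of h q]) (auto simp: h_def)
  also have "\<dots> = (\<Sum>T\<in>Pow V. (- 1) ^ card T * real (f (indic n T)))"
  proof (intro sum.cong refl)
    fix T assume "T \<in> Pow V"
    then have "T \<subseteq> {..<n}" using assms by auto
    then show "(- 1) ^ card T * h T = (- 1) ^ card T * real (f (indic n T))"
      by (simp add: ev h_def q_def mult.assoc[symmetric] power_add[symmetric])
  qed
  finally have "(- 1) ^ card V * (\<Sum>T\<in>Pow V. (- 1) ^ card T * real (f (indic n T))) = (- 1) ^ card V * q V"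
    by simp
  also have "\<dots> = p V" by (simp add: q_def mult.assoc[symmetric] power_add[symmetric])
  finally show ?thesis by (simp add: p_def)
qed

text \<open>Positivity excludes the default \<open>0\<close> inserted in \<open>deg\<close>, so the
  maximum comes from an actual monomial.\<close>

lemma deg_attained:
  assumes "deg n f > 0"
  obtains V where "V \<subseteq> {..<n}" "card V = deg n f" "multilinear_poly n f V \<noteq> 0"
proof -
  have "deg n f \<in> insert 0 (card ` {S \<in> Pow {..<n}. multilinear_poly n f S \<noteq> 0})"
    unfolding deg_def by (rule Max_in) auto
  then show ?thesis using assms that by auto
qed

section \<open>Sparsity of functions with an isolated value\<close>

lemma sum_cube:
  "(\<Sum>x\<in>cube n. g x) = (\<Sum>T\<in>Pow {..<n}. g (indic n T))"
proof (rule sum.reindex_bij_witness[of _ "indic n" "\<lambda>x. {i \<in> {..<n}. x i = 1}"])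
  fix T assume "T \<in> Pow {..<n}"
  then show "{i \<in> {..<n}. indic n T i = 1} = T" by (auto simp: indic_def)
qed (use cube_eq_indic indic_in_cube in auto)

lemma fourier_coeff_eq:
  assumes "S \<subseteq> {..<n}"
  shows "fourier_coeff n g S
    = (\<Sum>T\<in>Pow {..<n}. g (indic n T) * (- 1) ^ card (S \<inter> T)) / 2 ^ n"
proof -
  have "(\<Sum>i\<in>S. indic n T i) = card (S \<inter> T)" for T
  proof -
    have "(\<Sum>i\<in>S. indic n T i) = (\<Sum>i\<in>S. if i \<in> T then 1 else 0)"
      using assms by (intro sum.cong) (auto simp: indic_def)
    also have "\<dots> = card (S \<inter> T)"
      using assms finite_subset[of S "{..<n}"] by (simp add: sum.If_cases)
    finally show ?thesis .
  qed
  then show ?thesis by (simp add: fourier_coeff_def sum_cube)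
qed

text \<open>Fixing the coordinates outside \<open>W\<close> as in \<open>B\<close> merges all
  frequencies with the same trace \<open>R\<close> on \<open>W\<close>: the restricted coefficient
  at \<open>R\<close> is a signed sum of the coefficients at \<open>R \<union> Q\<close> with
  \<open>Q\<close> disjoint from \<open>W\<close>. Restriction therefore creates no new
  frequencies.\<close>

lemma fourier_coeff_restriction:
  assumes BW: "B \<subseteq> {..<n}" "W \<subseteq> {..<n}" "B \<inter> W = {}" and R: "R \<subseteq> W"
    and vanish: "\<And>S. S \<subseteq> {..<n} \<Longrightarrow> S \<inter> W = R \<Longrightarrow> fourier_coeff n g S = 0"
  shows "(\<Sum>U\<in>Pow W. g (indic n (B \<union> U)) * (- 1) ^ card (R \<inter> U)) = 0"
proof -
  define M where "M = {..<n} - W"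
  have fin: "finite M" "finite R" using R BW by (auto simp: M_def intro: finite_subset)
  have zero: "(\<Sum>T\<in>Pow {..<n}. g (indic n T) * (- 1) ^ card ((R \<union> Q) \<inter> T)) = 0" if "Q \<in> Pow M" for Q
  proof -
    have "R \<union> Q \<subseteq> {..<n}" "(R \<union> Q) \<inter> W = R" using that R BW by (auto simp: M_def)
    then show ?thesis using vanish[of "R \<union> Q"] by (simp add: fourier_coeff_eq)
  qed
  have card_split: "card ((R \<union> Q) \<inter> T) = card (R \<inter> T) + card (Q \<inter> T)" if "Q \<in> Pow M" for Q T
  proof -
    have "(R \<union> Q) \<inter> T = (R \<inter> T) \<union> (Q \<inter> T)" by blast
    moreover have "(R \<inter> T) \<inter> (Q \<inter> T) = {}" "finite Q"
      using that R fin by (auto simp: M_def intro: finite_subset)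
    ultimately show ?thesis using fin by (simp add: card_Un_disjoint)
  qed
  \<comment> \<open>Weighting by the character of \<open>B\<close> and summing over \<open>Q\<close>
    selects, by orthogonality, the points \<open>T\<close> that agree with \<open>B\<close> outside
    \<open>W\<close>.\<close>
  have "0 = (\<Sum>Q\<in>Pow M. (- 1) ^ card (Q \<inter> B) *
      (\<Sum>T\<in>Pow {..<n}. g (indic n T) * (- 1) ^ card ((R \<union> Q) \<inter> T)))"
    using zero by simp
  also have "\<dots> = (\<Sum>Q\<in>Pow M. \<Sum>T\<in>Pow {..<n}.
      g (indic n T) * (- 1) ^ card (R \<inter> T) * ((- 1) ^ card (Q \<inter> B) * (- 1) ^ card (Q \<inter> T)))"
    by (intro sum.cong refl) (simp add: sum_distrib_left card_split power_add algebra_simps)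
  also have "\<dots> = (\<Sum>T\<in>Pow {..<n}. g (indic n T) * (- 1) ^ card (R \<inter> T) *
      (\<Sum>Q\<in>Pow M. (- 1) ^ card (Q \<inter> B) * (- 1) ^ card (Q \<inter> T)))"
    by (subst sum.swap) (simp add: sum_distrib_left)
  also have "\<dots> = (\<Sum>T\<in>Pow {..<n}. if B \<inter> M = T \<inter> M then
      g (indic n T) * (- 1) ^ card (R \<inter> T) * 2 ^ card M else 0)"
    by (intro sum.cong refl) (simp add: character_orthogonality[OF fin(1)])
  also have "\<dots> = (\<Sum>T\<in>{T \<in> Pow {..<n}. B \<inter> M = T \<inter> M}.
      g (indic n T) * (- 1) ^ card (R \<inter> T) * 2 ^ card M)"
    by (rule sum.inter_filter[symmetric]) simp
  also have "\<dots> = (\<Sum>U\<in>Pow W. g (indic n (B \<union> U)) * (- 1) ^ card (R \<inter> U) * 2 ^ card M)"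
  proof (rule sum.reindex_bij_witness[of _ "\<lambda>U. B \<union> U" "\<lambda>T. T \<inter> W"])
    fix T assume T: "T \<in> {T \<in> Pow {..<n}. B \<inter> M = T \<inter> M}"
    then show eq: "B \<union> (T \<inter> W) = T" using BW by (auto simp: M_def)
    have "R \<inter> (T \<inter> W) = R \<inter> T" using R by blast
    then show "g (indic n (B \<union> T \<inter> W)) * (- 1) ^ card (R \<inter> (T \<inter> W)) * 2 ^ card M
        = g (indic n T) * (- 1) ^ card (R \<inter> T) * 2 ^ card M"
      by (simp add: eq)
  qed (use BW in \<open>auto simp: M_def\<close>)
  also have "\<dots> = (\<Sum>U\<in>Pow W. g (indic n (B \<union> U)) * (- 1) ^ card (R \<inter> U)) * 2 ^ card M"
    by (simp add: sum_distrib_right)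
  finally show ?thesis by simp
qed

text \<open>The restriction is a constant plus a nonzero multiple of the point mass at
  \<open>P\<close>. The constant is seen only by the frequency \<open>{}\<close> and the point mass
  by every frequency, so each nonempty \<open>R \<subseteq> W\<close> is the trace of some frequency
  of \<open>f\<close>.\<close>

lemma sparsity_isolated_value:
  assumes BW: "B \<subseteq> {..<n}" "W \<subseteq> {..<n}" "B \<inter> W = {}" and "P \<subseteq> W" "W \<noteq> {}"
    and const: "\<And>U. U \<subseteq> W \<Longrightarrow> U \<noteq> P \<Longrightarrow> f (indic n (B \<union> U)) = c"
    and iso: "f (indic n (B \<union> P)) \<noteq> c"
  shows "real (card W) \<le> log 2 (sparsity n f) + 1"
proof -
  define g where "g x = 1 - 2 * real (f x)" for x
  define \<S> where "\<S> = {S \<in> Pow {..<n}. fourier_coeff n g S \<noteq> 0}"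
  have finW: "finite W" using BW finite_subset by blast
  have "R \<in> (\<lambda>S. S \<inter> W) ` \<S>" if R: "R \<in> Pow W - {{}}" for R
  proof (rule ccontr)
    assume "R \<notin> (\<lambda>S. S \<inter> W) ` \<S>"
    then have "fourier_coeff n g S = 0" if "S \<subseteq> {..<n}" "S \<inter> W = R" for S
      using that by (auto simp: \<S>_def)
    then have "0 = (\<Sum>U\<in>Pow W. g (indic n (B \<union> U)) * (- 1) ^ card (R \<inter> U))"
      using fourier_coeff_restriction[of B n W R g] BW R by auto
    also have "\<dots> = (\<Sum>U\<in>Pow W. (1 - 2 * real c) * (- 1) ^ card (R \<inter> U)
        + (if U = P then (g (indic n (B \<union> P)) - (1 - 2 * real c)) * (- 1) ^ card (R \<inter> P) else 0))"
      using const by (intro sum.cong refl) (auto simp: g_def algebra_simps)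
    also have "\<dots> = (1 - 2 * real c) * (\<Sum>U\<in>Pow W. (- 1) ^ card (R \<inter> U))
        + (g (indic n (B \<union> P)) - (1 - 2 * real c)) * (- 1) ^ card (R \<inter> P)"
      using \<open>P \<subseteq> W\<close> finW by (simp add: sum.distrib sum_distrib_left)
    also have "(\<Sum>U\<in>Pow W. (- 1 :: real) ^ card (R \<inter> U)) = 0"
      using character_orthogonality[OF finW, of R "{}"] R by (auto simp: Int_commute)
    finally show False using iso by (simp add: g_def)
  qed
  then have "card (Pow W - {{}}) \<le> card ((\<lambda>S. S \<inter> W) ` \<S>)"
    by (intro card_mono) (auto simp: \<S>_def)
  also have "\<dots> \<le> card \<S>" by (intro card_image_le) (auto simp: \<S>_def)
  also have "card \<S> = sparsity n f" by (simp add: \<S>_def sparsity_def g_def[abs_def])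
  finally have le: "2 ^ card W - 1 \<le> sparsity n f"
    using finW by (simp add: card_Pow)
  \<comment> \<open>For nonempty \<open>W\<close>, \<open>2 ^ card W - 1\<close> is at least
    \<open>2 ^ (card W - 1)\<close>; this rounding costs the \<open>+ 1\<close> in the
    bound.\<close>
  obtain k where k: "card W = Suc k"
    using finW \<open>W \<noteq> {}\<close> by (metis card_0_eq not0_implies_Suc)
  have "(1::nat) \<le> 2 ^ k" by simp
  then have "2 ^ k \<le> sparsity n f" using le k by simp
  then have "(2::real) ^ k \<le> real (sparsity n f)"
    by (metis of_nat_le_iff of_nat_numeral of_nat_power)
  then have "real k \<le> log 2 (sparsity n f)" by (simp add: le_log_of_power)
  then show ?thesis using k by simp
qed

section \<open>Alternation and sensitivity\<close>

text \<open>Only the ends of a path and its number of value changes are recorded, so that joining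
  paths adds the counts.\<close>

inductive alt_path :: "(nat set \<Rightarrow> 'a) \<Rightarrow> nat set \<Rightarrow> nat set \<Rightarrow> nat \<Rightarrow> bool"
  for F :: "nat set \<Rightarrow> 'a" and S :: "nat set" where
  refl: "alt_path F S S 0"
| step: "alt_path F S T k \<Longrightarrow> i \<notin> T \<Longrightarrow> alt_path F S (insert i T) (k + of_bool (F T \<noteq> F (insert i T)))"

lemma alt_path_trans:
  assumes "alt_path F T U l" "alt_path F S T k"
  shows "alt_path F S U (k + l)"
  using assms
proof induction
  case (step U l i)
  then show ?case using alt_path.step[of F S U "k + l" i] by (simp add: add.assoc)
qed simp

text \<open>The elements of \<open>U - S\<close> are added one at a time; different values at the
  ends force a change on the way.\<close>

lemma alt_path_exists:
  assumes "finite U" "S \<subseteq> U"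
  shows "\<exists>k. alt_path F S U k \<and> (F S \<noteq> F U \<longrightarrow> 1 \<le> k)"
proof -
  have "\<exists>k. alt_path F S (S \<union> D) k \<and> (F S \<noteq> F (S \<union> D) \<longrightarrow> 1 \<le> k)"
    if "finite D" "D \<inter> S = {}" for D
    using that
  proof (induction D rule: finite_induct)
    case empty
    show ?case using alt_path.refl[of F S] by auto
  next
    case (insert i D)
    then obtain k where k: "alt_path F S (S \<union> D) k" "F S \<noteq> F (S \<union> D) \<longrightarrow> 1 \<le> k" by auto
    have "i \<notin> S \<union> D" using insert by auto
    from alt_path.step[OF k(1) this] k(2) show ?case
      by (intro exI[of _ "k + of_bool (F (S \<union> D) \<noteq> F (insert i (S \<union> D)))"]) auto
  qed
  from this[of "U - S"] show ?thesis using assms by (simp add: Un_absorb1 Diff_Int_distrib2)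
qed

text \<open>Recovers the vertices that \<open>alt_path\<close> forgets, numbered as in
  \<open>is_chain\<close>.\<close>

lemma alt_path_chain:
  assumes "alt_path F {} T k" 
  shows "finite T \<and> (\<exists>X. X 0 = {} \<and> X (card T) = T \<and> (\<forall>i\<in>{1..card T}. X (i - 1) \<subset> X i)
    \<and> (\<forall>i\<le>card T. X i \<subseteq> T) \<and> card {i \<in> {1..card T}. F (X (i - 1)) \<noteq> F (X i)} = k)"
  using assms
proof induction
  case refl
  show ?case by (auto intro: exI[of _ "\<lambda>_. {}"])
next
  case (step T k j)
  then obtain X where X: "finite T" "X 0 = {}" "X (card T) = T" "\<forall>i\<in>{1..card T}. X (i - 1) \<subset> X i"
    "\<forall>i\<le>card T. X i \<subseteq> T" "card {i \<in> {1..card T}. F (X (i - 1)) \<noteq> F (X i)} = k" by blast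
  define d where "d = card T"
  define Y where "Y = X(Suc d := insert j T)"
  have card: "card (insert j T) = Suc d" using X step by (simp add: d_def)
  have Y: "Y i = X i" if "i \<le> d" for i using that by (simp add: Y_def)
  have "{i \<in> {1..Suc d}. F (Y (i - 1)) \<noteq> F (Y i)}
      = {i \<in> {1..d}. F (X (i - 1)) \<noteq> F (X i)} \<union> (if F T \<noteq> F (insert j T) then {Suc d} else {})"
    using X(3) by (auto simp: Y_def d_def le_Suc_eq)
  then have "card {i \<in> {1..Suc d}. F (Y (i - 1)) \<noteq> F (Y i)} = k + of_bool (F T \<noteq> F (insert j T))"
    using X(6) by (auto simp: d_def)
  moreover have "\<forall>i\<in>{1..Suc d}. Y (i - 1) \<subset> Y i"
    using X(3,4) step.hyps by (auto simp: Y_def d_def le_Suc_eq)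
  moreover have "\<forall>i\<le>Suc d. Y i \<subseteq> insert j T"
    using X(5) by (auto simp: Y_def d_def le_Suc_eq)
  moreover have "Y 0 = {}" "Y (Suc d) = insert j T" using X by (simp_all add: Y_def)
  ultimately show ?case using X(1) card by (intro conjI exI[of _ Y]) auto
qed

lemma alt_path_le_alt:
  assumes "alt_path (\<lambda>T. f (indic n T)) {} {..<n} k"
  shows "k \<le> alt n f"
proof -
  obtain X where X: "X 0 = {}" "X n = {..<n}" "\<forall>i\<in>{1..n}. X (i - 1) \<subset> X i" "\<forall>i\<le>n. X i \<subseteq> {..<n}"
    "card {i \<in> {1..n}. f (indic n (X (i - 1))) \<noteq> f (indic n (X i))} = k"
    using alt_path_chain[OF assms] by auto
  have "prec n (indic n (X (i - 1))) (indic n (X i))" if i: "i \<in> {1..n}" for i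
  proof -
    obtain j where j: "j \<in> X i" "j \<notin> X (i - 1)" using X(3) i by blast
    then have "j < n" using X(4) i by auto
    then have "indic n (X (i - 1)) j \<noteq> indic n (X i) j" using j by (simp add: indic_def)
    then have "indic n (X (i - 1)) \<noteq> indic n (X i)" by metis
    moreover have "indic n (X (i - 1)) q \<le> indic n (X i) q" if "q < n" for q
      using X(3) i that by (auto simp: indic_def)
    ultimately show ?thesis by (simp add: prec_def)
  qed
  then have "is_chain n (\<lambda>i. indic n (X i))"
    using X(1,2) by (auto simp: is_chain_def indic_in_cube const_point_def) (auto simp: indic_def)
  then have "k \<in> {card {i \<in> {1..n}. f (X (i - 1)) \<noteq> f (X i)} | X. is_chain n X}"
    using X(5) by (intro CollectI exI[of _ "\<lambda>i. indic n (X i)"]) simp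
  then show ?thesis unfolding alt_def by (intro Max_ge finite_alternations)
qed

section \<open>Walks through an interval between isolated values\<close>

text \<open>The upper end \<open>U\<close> descends to a maximal \<open>Z\<close> with another
  value. Hypothesis \<open>L\<close> pays for the skipped interval, whose bottom is isolated, and
  each descent uses up one of the \<open>k\<close> permitted changes.\<close>

lemma up_sensitivity_bound:
  fixes L :: real
  assumes "0 \<le> L" "finite U" "S \<subseteq> U"
    and "\<And>l. alt_path F S U l \<Longrightarrow> l \<le> k"
    and "\<And>i. i \<in> U - S \<Longrightarrow> F (insert i S) \<noteq> F S"
    and L: "\<And>Z Y. S \<subseteq> Z \<Longrightarrow> Z \<subset> Y \<Longrightarrow> Y \<subseteq> U \<Longrightarrow> F Z \<noteq> F Y \<Longrightarrow>
      (\<And>X. Z \<subset> X \<Longrightarrow> X \<subseteq> Y \<Longrightarrow> F X = F Y) \<Longrightarrow> real (card (Y - Z)) \<le> L"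
  shows "real (card (U - S)) \<le> real k * L"
  using assms
proof (induction k arbitrary: U rule: less_induct)
  case (less k U)
  note altle = less.prems(4) and sens = less.prems(5) and L = less.prems(6)
  show ?case
  proof (cases "U = S")
    case True
    then show ?thesis using \<open>0 \<le> L\<close> by simp
  next
    case False
    then obtain i where i: "i \<in> U - S" using less.prems by blast
    define \<Z> where "\<Z> = {Z. S \<subseteq> Z \<and> Z \<subseteq> U \<and> F Z \<noteq> F U}"
    \<comment> \<open>Sensitivity at \<open>S\<close> keeps the walk going: \<open>S\<close> and
      \<open>insert i S\<close> have different values, so they cannot both share the value of
      \<open>U\<close>.\<close>
    have "S \<in> \<Z> \<or> insert i S \<in> \<Z>" using sens[OF i] i less.prems(3) by (auto simp: \<Z>_def)
    moreover have "finite \<Z>" using less.prems(2) by (simp add: \<Z>_def)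
    ultimately obtain Z where Z: "Z \<in> \<Z>" "\<And>X. X \<in> \<Z> \<Longrightarrow> Z \<subseteq> X \<Longrightarrow> Z = X"
      using finite_has_maximal[of \<Z>] by blast
    then have ZU: "S \<subseteq> Z" "Z \<subset> U" "F Z \<noteq> F U" by (auto simp: \<Z>_def)
    have "F X = F U" if "Z \<subset> X" "X \<subseteq> U" for X
      using Z(2)[of X] that ZU(1) by (auto simp: \<Z>_def)
    then have "real (card (U - Z)) \<le> L"
      using ZU by (intro L) blast+
    obtain l where l: "alt_path F Z U l" "1 \<le> l"
      using alt_path_exists[of U Z F] less.prems(2) ZU by blast
    obtain l' where l': "alt_path F S Z l'"
      using alt_path_exists[of Z S F] ZU less.prems(2) by (meson finite_subset psubset_imp_subset)
    \<comment> \<open>Every path from \<open>S\<close> to \<open>Z\<close> continues to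
      \<open>U\<close> with at least one more change. Applied to \<open>l'\<close>, this gives
      \<open>0 < k\<close>, so \<open>k - 1\<close> is a true predecessor.\<close>
    have below: "m < k" "m \<le> k - 1" if "alt_path F S Z m" for m
      using altle[OF alt_path_trans[OF l(1) that]] l(2) by auto
    have "k - 1 < k" using below[OF l'] by simp
    then have "real (card (Z - S)) \<le> real (k - 1) * L"
    proof (rule less.IH)
      show "F (insert i S) \<noteq> F S" if "i \<in> Z - S" for i
        using that ZU by (intro sens) auto
      show "real (card (Y - X)) \<le> L" if "S \<subseteq> X" "X \<subset> Y" "Y \<subseteq> Z" "F X \<noteq> F Y"
        "\<And>Q. X \<subset> Q \<Longrightarrow> Q \<subseteq> Y \<Longrightarrow> F Q = F Y" for X Y
        using that ZU by (intro L) blast+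
    qed (use \<open>0 \<le> L\<close> less.prems(2) ZU below in \<open>auto intro: finite_subset\<close>)
    moreover have "card (U - S) = card (U - Z) + card (Z - S)"
    proof -
      have "U - S = (U - Z) \<union> (Z - S)" using ZU by auto
      moreover have "finite (U - Z)" "finite (Z - S)" "(U - Z) \<inter> (Z - S) = {}"
        using less.prems(2) ZU by (auto intro: finite_subset)
      ultimately show ?thesis by (simp add: card_Un_disjoint)
    qed
    moreover have "real k * L = real (k - 1) * L + L"
      using \<open>k - 1 < k\<close> by (cases k) (simp_all add: distrib_right)
    ultimately show ?thesis using \<open>real (card (U - Z)) \<le> L\<close> by linarith
  qed
qed

text \<open>The order dual: \<open>U\<close> is fixed and the lower end \<open>S\<close> climbs to a
  minimal \<open>Z\<close> with another value, so the isolated value sits at the top of each skipped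
  interval.\<close>

lemma down_sensitivity_bound:
  fixes L :: real
  assumes "0 \<le> L" "finite U" "S \<subseteq> U"
    and "\<And>l. alt_path F S U l \<Longrightarrow> l \<le> k"
    and "\<And>i. i \<in> U - S \<Longrightarrow> F (U - {i}) \<noteq> F U"
    and L: "\<And>Z Y. S \<subseteq> Z \<Longrightarrow> Z \<subset> Y \<Longrightarrow> Y \<subseteq> U \<Longrightarrow> F Y \<noteq> F Z \<Longrightarrow>
      (\<And>X. Z \<subseteq> X \<Longrightarrow> X \<subset> Y \<Longrightarrow> F X = F Z) \<Longrightarrow> real (card (Y - Z)) \<le> L"
  shows "real (card (U - S)) \<le> real k * L"
  using assms
proof (induction k arbitrary: S rule: less_induct)
  case (less k S)
  note altle = less.prems(4) and sens = less.prems(5) and L = less.prems(6)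
  show ?case
  proof (cases "U = S")
    case True
    then show ?thesis using \<open>0 \<le> L\<close> by simp
  next
    case False
    then obtain i where i: "i \<in> U - S" using less.prems by blast
    define \<Z> where "\<Z> = {Z. S \<subseteq> Z \<and> Z \<subseteq> U \<and> F Z \<noteq> F S}"
    have "U \<in> \<Z> \<or> U - {i} \<in> \<Z>" using sens[OF i] i less.prems(3) by (auto simp: \<Z>_def)
    moreover have "finite \<Z>" using less.prems(2) by (simp add: \<Z>_def)
    ultimately obtain Z where Z: "Z \<in> \<Z>" "\<And>X. X \<in> \<Z> \<Longrightarrow> X \<subseteq> Z \<Longrightarrow> Z = X"
      using finite_has_minimal[of \<Z>] by blast
    then have ZU: "S \<subset> Z" "Z \<subseteq> U" "F Z \<noteq> F S" by (auto simp: \<Z>_def)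
    have finZ: "finite Z" using ZU less.prems(2) finite_subset by blast
    have "F X = F S" if "S \<subseteq> X" "X \<subset> Z" for X
      using Z(2)[of X] that ZU(2) by (auto simp: \<Z>_def)
    then have "real (card (Z - S)) \<le> L"
      using ZU by (intro L) blast+
    obtain l where l: "alt_path F S Z l" "1 \<le> l"
      using alt_path_exists[of Z S F] finZ ZU by force
    obtain l' where l': "alt_path F Z U l'"
      using alt_path_exists[of U Z F] ZU less.prems(2) by blast
    have above: "m < k" "m \<le> k - 1" if "alt_path F Z U m" for m
      using altle[OF alt_path_trans[OF that l(1)]] l(2) by auto
    have "k - 1 < k" using above[OF l'] by simp
    then have "real (card (U - Z)) \<le> real (k - 1) * L"
    proof (rule less.IH)
      show "real (card (Y - X)) \<le> L" if "Z \<subseteq> X" "X \<subset> Y" "Y \<subseteq> U" "F Y \<noteq> F X"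
        "\<And>Q. X \<subseteq> Q \<Longrightarrow> Q \<subset> Y \<Longrightarrow> F Q = F X" for X Y
        using that ZU by (intro L) blast+
      show "F (U - {i}) \<noteq> F U" if "i \<in> U - Z" for i
        using that ZU by (intro sens) auto
    qed (use \<open>0 \<le> L\<close> less.prems(2) ZU above in auto)
    moreover have "card (U - S) = card (U - Z) + card (Z - S)"
    proof -
      have "U - S = (U - Z) \<union> (Z - S)" using ZU by auto
      moreover have "finite (U - Z)" "finite (Z - S)" "(U - Z) \<inter> (Z - S) = {}"
        using less.prems(2) finZ by auto
      ultimately show ?thesis by (simp add: card_Un_disjoint)
    qed
    moreover have "real k * L = real (k - 1) * L + L"
      using \<open>k - 1 < k\<close> by (cases k) (simp_all add: distrib_right)
    ultimately show ?thesis using \<open>real (card (Z - S)) \<le> L\<close> by linarith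
  qed
qed

text \<open>Sensitive coordinates outside \<open>T\<close> are counted on the interval from
  \<open>T\<close> to \<open>T \<union> A\<close>, those inside on the interval from
  \<open>T - D\<close> to \<open>T\<close>; the two counts give the factor \<open>2\<close>.\<close>

theorem sensitivity_le_alt_log_sparsity:
  assumes VT: "T \<subseteq> {..<n}" "V \<subseteq> {..<n}"
  shows "real (card (sens_coords (\<lambda>T. f (indic n T)) V T))
    \<le> 2 * real (alt n f) * (log 2 (sparsity n f) + 1)"
proof -
  define F where "F T = f (indic n T)" for T
  define L where "L = log 2 (sparsity n f) + 1"
  define A where "A = {i \<in> sens_coords F V T. i \<notin> T}"
  define D where "D = {i \<in> sens_coords F V T. i \<in> T}"
  \<comment> \<open>A positive sparsity is at least \<open>1\<close>; sparsity \<open>0\<close> is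
    settled by the default value of \<open>ln\<close> at \<open>0\<close>.\<close>
  have "0 \<le> log 2 (sparsity n f)"
    by (cases "sparsity n f = 0") (auto simp: log_def)
  then have L0: "0 \<le> L" by (simp add: L_def)
  have sub: "A \<subseteq> {..<n}" "D \<subseteq> {..<n}" "D \<subseteq> T" "A \<inter> T = {}"
    using VT by (auto simp: A_def D_def sens_coords_def)
  have finT: "finite T" "finite A" "finite D" using VT sub by (auto intro: finite_subset)
  \<comment> \<open>The path is extended down to \<open>{}\<close> and up to \<open>{..<n}\<close>,
    which can only add changes.\<close>
  have altle: "l \<le> alt n f" if path: "alt_path F S U l" "S \<subseteq> U" "U \<subseteq> {..<n}" for S U l
  proof -
    have "finite S" using path by (auto intro: finite_subset)
    then obtain p where p: "alt_path F {} S p" using alt_path_exists[of S "{}" F] by auto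
    obtain q where q: "alt_path F U {..<n} q" using alt_path_exists[of "{..<n}" U F] path(3) by blast
    have "alt_path F {} {..<n} (p + l + q)"
      using alt_path_trans[OF q alt_path_trans[OF path(1) p]] .
    then have "p + l + q \<le> alt n f" by (intro alt_path_le_alt) (simp add: F_def[abs_def])
    then show ?thesis by simp
  qed
  \<comment> \<open>Serves both directions: \<open>P\<close> is \<open>{}\<close> for an isolated
    bottom and \<open>Y - Z\<close> for an isolated top.\<close>
  have iso: "real (card (Y - Z)) \<le> L"
    if "Z \<subset> Y" "Y \<subseteq> {..<n}" "P \<subseteq> Y - Z" "F (Z \<union> P) \<noteq> c"
      "\<And>X. Z \<subseteq> X \<Longrightarrow> X \<subseteq> Y \<Longrightarrow> X \<noteq> Z \<union> P \<Longrightarrow> F X = c" for Z Y P c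
    unfolding L_def
  proof (rule sparsity_isolated_value[of Z n "Y - Z" P f c])
    fix U assume U: "U \<subseteq> Y - Z" "U \<noteq> P"
    then have "Z \<union> U \<noteq> Z \<union> P" using that(3) by blast
    then have "F (Z \<union> U) = c" using U that(1) by (intro that(5)) auto
    then show "f (indic n (Z \<union> U)) = c" by (simp add: F_def)
  qed (use that in \<open>auto simp: F_def\<close>)
  have "real (card (T \<union> A - T)) \<le> real (alt n f) * L"
  proof (rule up_sensitivity_bound[of L "T \<union> A" T F])
    show "F (insert i T) \<noteq> F T" if "i \<in> T \<union> A - T" for i
      using that by (auto simp: A_def sens_coords_def flip_def)
    show "real (card (Y - Z)) \<le> L" if "T \<subseteq> Z" "Z \<subset> Y" "Y \<subseteq> T \<union> A" "F Z \<noteq> F Y"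
      "\<And>X. Z \<subset> X \<Longrightarrow> X \<subseteq> Y \<Longrightarrow> F X = F Y" for Z Y
    proof (rule iso[of Z Y "{}" "F Y"])
      show "F X = F Y" if "Z \<subseteq> X" "X \<subseteq> Y" "X \<noteq> Z \<union> {}" for X
        using that \<open>\<And>X. Z \<subset> X \<Longrightarrow> X \<subseteq> Y \<Longrightarrow> F X = F Y\<close> by blast
    qed (use that(2-4) VT sub in auto)
  qed (use L0 finT altle VT sub in auto)
  moreover have "real (card (T - (T - D))) \<le> real (alt n f) * L"
  proof (rule down_sensitivity_bound[of L T "T - D" F])
    show "F (T - {i}) \<noteq> F T" if "i \<in> T - (T - D)" for i
      using that by (auto simp: D_def sens_coords_def flip_def)
    show "real (card (Y - Z)) \<le> L" if "T - D \<subseteq> Z" "Z \<subset> Y" "Y \<subseteq> T" "F Y \<noteq> F Z"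
      "\<And>X. Z \<subseteq> X \<Longrightarrow> X \<subset> Y \<Longrightarrow> F X = F Z" for Z Y
    proof (rule iso[of Z Y "Y - Z" "F Z"])
      have "Z \<union> (Y - Z) = Y" using \<open>Z \<subset> Y\<close> by blast
      then show "F (Z \<union> (Y - Z)) \<noteq> F Z" using \<open>F Y \<noteq> F Z\<close> by simp
      show "F X = F Z" if "Z \<subseteq> X" "X \<subseteq> Y" "X \<noteq> Z \<union> (Y - Z)" for X
        using that \<open>Z \<union> (Y - Z) = Y\<close> \<open>\<And>X. Z \<subseteq> X \<Longrightarrow> X \<subset> Y \<Longrightarrow> F X = F Z\<close> by blast
    qed (use that(2,3) VT in auto)
  qed (use L0 finT altle VT sub in auto)
  moreover have "T \<union> A - T = A" "T - (T - D) = D" using sub by auto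
  moreover have "card (sens_coords F V T) = card A + card D"
  proof -
    have "sens_coords F V T = A \<union> D" "A \<inter> D = {}" by (auto simp: A_def D_def)
    then show ?thesis using finT by (simp add: card_Un_disjoint)
  qed
  ultimately show ?thesis by (simp add: F_def[abs_def] L_def)
qed

section \<open>Degree against alternation and sparsity\<close>

text \<open>Huang's bound is applied on the subcube \<open>Pow V\<close> of a monomial of top
  degree, where the coordinates outside \<open>V\<close> are \<open>0\<close>; the directions
  sensitive there are also sensitive for \<open>f\<close>.\<close>

theorem sqrt_deg_le_alt_log_sparsity:
  assumes "f \<in> cube n \<rightarrow> {0, 1}" "deg n f > 0"
  shows "sqrt (deg n f) \<le> 2 * real (alt n f) * (log 2 (sparsity n f) + 1)"
proof -
  obtain V where V: "V \<subseteq> {..<n}" "card V = deg n f" "multilinear_poly n f V \<noteq> 0"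
    using deg_attained[OF assms(2)] .
  have "finite V" "V \<noteq> {}" using V assms(2) by (auto intro: finite_subset)
  moreover have "f (indic n T) \<in> {0, 1}" for T using assms(1) indic_in_cube by blast
  moreover have "(\<Sum>T\<in>Pow V. (- 1) ^ card T * real (f (indic n T))) \<noteq> 0"
    using V(1,3) by (auto simp: multilinear_poly_coeff)
  ultimately obtain T where T: "T \<subseteq> V"
    "sqrt (card V) \<le> card (sens_coords (\<lambda>T. f (indic n T)) V T)"
    using sensitivity_ge_sqrt[of V "\<lambda>T. f (indic n T)"] by blast
  then have "T \<subseteq> {..<n}" using V(1) by auto
  from sensitivity_le_alt_log_sparsity[OF this V(1), of f] T(2) V(2) show ?thesis by simp
qed

theorem theorem4:
  fixes a :: real
  assumes "a \<ge> 0"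
  shows "\<exists>c>0. \<exists>D::real. \<forall>n. \<forall>f \<in> cube n \<rightarrow> {0, 1}.
           real (alt n f) \<le> a \<longrightarrow> real (deg n f) \<ge> D \<longrightarrow>
           log 2 (real (sparsity n f)) \<ge> c * sqrt (real (deg n f))"
\<comment> \<open>The threshold on the degree makes the additive term \<open>2 * (a + 1)\<close> at
  most half of \<open>sqrt (deg n f)\<close>; absorbing it doubles the factor
  \<open>2 * (a + 1)\<close>. Using \<open>a + 1\<close> in place of \<open>a\<close> keeps the
  divisor positive when \<open>a = 0\<close>.\<close>
proof (rule exI[of _ "1 / (4 * (a + 1))"], intro exI[of _ "(4 * (a + 1))\<^sup>2"] conjI allI ballI impI)
  show "0 < 1 / (4 * (a + 1))" using assms by simp
next
  fix n f assume f: "f \<in> cube n \<rightarrow> {0, 1}" "real (alt n f) \<le> a" "(4 * (a + 1))\<^sup>2 \<le> real (deg n f)"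
  define l where "l = log 2 (sparsity n f)"
  have l0: "0 \<le> l" by (cases "sparsity n f = 0") (auto simp: l_def log_def)
  have root: "4 * (a + 1) \<le> sqrt (deg n f)" using f(3) by (rule real_le_rsqrt)
  moreover have "0 < 4 * (a + 1)" using assms by simp
  ultimately have "0 < sqrt (deg n f)" by (rule less_le_trans[rotated])
  then have "sqrt (deg n f) \<le> 2 * real (alt n f) * (l + 1)"
    unfolding l_def using f(1) by (intro sqrt_deg_le_alt_log_sparsity) auto
  also have "\<dots> \<le> 2 * (a + 1) * (l + 1)"
    using f(2) l0 by (intro mult_right_mono) auto
  finally have "sqrt (deg n f) \<le> 2 * (a + 1) * l + 2 * (a + 1)" by (simp add: algebra_simps)
  then have "sqrt (deg n f) \<le> 4 * (a + 1) * l" using root by linarith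
  then show "1 / (4 * (a + 1)) * sqrt (deg n f) \<le> log 2 (sparsity n f)"
    using assms unfolding l_def[symmetric] by (simp add: pos_divide_le_eq mult.commute)
qed

end
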